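(* Let $\operatorname{des}$ denote the number of descents of a uniformly random permutation of length $n$, and let $r\ge 1$. Then $$\mathbb E(\operatorname{des}^r)=\sum_{m=2}^{\min(n,2r)}\ \sum_{u=1}^{\lfloor m/2\rfloor}\left(\sum_{w=0}^{m-u}(-1)^w\binom{m-u}{w}(m-u-w)^r\right)\left(\sum_{\substack{q_1+\dots+q_u=m\\ q_i\ge 2}}\binom{m}{q_1,\dots,q_u}\right)\frac{\binom{n-(m-u)}{u}}{m!}.$$
   Context: For a permutation $\sigma=\sigma_1\cdots\sigma_n$ of $\{1,\dots,n\}$, $\operatorname{des}(\sigma)$ is the number of indices $i\in\{1,\dots,n-1\}$ with $\sigma_i>\sigma_{i+1}$. The expectation is with respect to the uniform distribution on the permutations of $\{1,\dots,n\}$. The inner sum over $q_1+\dots+q_u=m$ runs over ordered tuples of integers $q_i\ge 2$, and $\binom{m}{q_1,\dots,q_u}$ is the multinomial coefficient. *)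

theory Defs
  imports "HOL-Probability.Probability" "HOL-Combinatorics.Permutations"
begin

definition des :: "nat \<Rightarrow> (nat \<Rightarrow> nat) \<Rightarrow> nat" where
  "des n \<sigma> = card {i \<in> {1..<n}. \<sigma> i > \<sigma> (i + 1)}"

definition uniform_perm :: "nat \<Rightarrow> (nat \<Rightarrow> nat) pmf" where
  "uniform_perm n = pmf_of_set {\<sigma>. \<sigma> permutes {1..n}}"

text \<open>Ordered tuples $(q_1, \dots, q_u)$ are lists of length \<open>u\<close>.\<close>

definition tuples_ge2 :: "nat \<Rightarrow> nat \<Rightarrow> nat list set" where
  "tuples_ge2 m u = {q. length q = u \<and> sum_list q = m \<and> (\<forall>x \<in> set q. x \<ge> 2)}"

text \<open>Only used for lists \<open>q\<close> with \<open>sum_list q = m\<close>.\<close>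

definition multinomial :: "nat \<Rightarrow> nat list \<Rightarrow> real" where
  "multinomial m q = fact m / (\<Prod>x\<leftarrow>q. fact x)"

text \<open>The set of permutations is finite and nonempty, so \<open>pmf_of_set\<close> is the uniform
  distribution, and sums over \<open>tuples_ge2\<close> are genuine finite sums.\<close>

lemma finite_perms: "finite {\<sigma>. \<sigma> permutes {1..n::nat}}"
  by (rule finite_permutations) simp

lemma perms_nonempty: "{\<sigma>. \<sigma> permutes {1..n::nat}} \<noteq> {}"
  using permutes_id by blast

lemma finite_tuples_ge2: "finite (tuples_ge2 m u)"
proof (rule finite_subset)
  show "tuples_ge2 m u \<subseteq> {q. set q \<subseteq> {..m} \<and> length q = u}"
    by (auto simp: tuples_ge2_def member_le_sum_list)
  show "finite {q. set q \<subseteq> {..m} \<and> length q = u}"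
    by (rule finite_lists_length_eq) simp
qed

end

theory Submission
  imports Defs "HOL-Computational_Algebra.Formal_Power_Series"
begin

text \<open>
  Write \<open>E = exp z - 1\<close> and let \<open>[z^r]\<close> extract a coefficient. Everything is read off from powers
  of \<open>E\<close>.

  Expanding \<open>exp (x z) = (1 + E)^x\<close> gives
  \<open>x^r = (\<Sum>k. r! [z^r] E^k \<cdot> (x choose k))\<close> (\<open>power_eq_sum_binomial\<close>), and expanding \<open>E^k\<close> in powers
  of \<open>exp z\<close> shows that \<open>r! [z^r] E^k\<close> is the alternating sum over \<open>w\<close> in the theorem, with
  \<open>k = m - u\<close> (\<open>surjection_count_fps\<close>). It vanishes for \<open>k > r\<close>, which is where the bound
  \<open>m \<le> 2 r\<close> comes from. So only the binomial moments of the number of descents are missing.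

  These are \<open>[z^n] E^(n - k)\<close>, by Frobenius' identity
  \<open>(\<Sum>\<sigma>. des \<sigma> choose k) = n! [z^n] E^(n - k)\<close> (\<open>sum_des_choose\<close>); the right-hand side counts the
  ordered partitions of an \<open>n\<close>-element set into \<open>n - k\<close> blocks. Both sides satisfy the same
  recurrence: on the left it comes from inserting the new maximum \<open>n + 1\<close> at each possible
  position (\<open>des_insert_max\<close>), on the right from the differential equation
  \<open>(E^(j+1))' = (j + 1) (E^(j+1) + E^j)\<close>.

  Finally, with \<open>E = z + G\<close> (\<open>G\<close> is called \<open>exp_tail\<close>), the binomial expansion of \<open>E^(n - k)\<close> chooses the \<open>u\<close> among the
  \<open>n - k\<close> blocks that have size at least 2. The coefficient of \<open>z^(k + u)\<close> in \<open>G^u\<close> is the sum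
  of multinomial coefficients over the tuples \<open>q\<close>, divided by \<open>(k + u)!\<close>, and \<open>m = k + u\<close> is the
  total size of these blocks.
\<close>

unbundle no vec_syntax
unbundle fps_syntax

section \<open>Powers of the exponential series\<close>

abbreviation exp_minus_1 :: "real fps" where
  "exp_minus_1 \<equiv> fps_exp 1 - 1"

lemma exp_minus_1_power_nth_eq_0:
  assumes "n < k"
  shows "(exp_minus_1 ^ k) $ n = 0"
  using assms by (intro startsby_zero_power_prefix[rule_format]) auto

text \<open>
  Both sides count the surjections from an \<open>r\<close>-element set onto a \<open>k\<close>-element set. The left-hand
  side is what the binomial theorem gives for \<open>(exp z - 1)^k\<close>.
\<close>

lemma surjection_count_fps:
  "(\<Sum>w = 0..k. (-1) ^ w * real (k choose w) * real (k - w) ^ r)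
     = fact r * (exp_minus_1 ^ k) $ r"
proof -
  have "exp_minus_1 ^ k = (- 1 + fps_exp 1) ^ k"
    by simp
  also have "\<dots> = (\<Sum>w\<le>k. of_nat (k choose w) * (- 1) ^ w * fps_exp 1 ^ (k - w))"
    by (rule binomial_ring)
  also have "\<dots> = (\<Sum>w\<le>k. fps_const (real (k choose w) * (- 1) ^ w) * fps_exp (real (k - w)))"
    by (intro sum.cong refl)
       (simp add: fps_exp_power_mult fps_of_nat flip: fps_const_mult fps_const_power fps_const_neg)
  finally have "(exp_minus_1 ^ k) $ r
      = (\<Sum>w\<le>k. real (k choose w) * (- 1) ^ w * (real (k - w) ^ r / fact r))"
    by (simp add: fps_sum_nth)
  then show ?thesis
    by (simp add: sum_distrib_left atMost_atLeast0 mult_ac)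
qed

text \<open>
  The coefficient of \<open>z^r\<close> in \<open>exp (x z) = ((exp z - 1) + 1)^x\<close>. The summation bound may be any
  \<open>n \<ge> x\<close>, so that the same range serves all values \<open>x\<close> of the number of descents.
\<close>

lemma power_eq_sum_binomial:
  assumes "x \<le> n"
  shows "real x ^ r = (\<Sum>k\<le>n. fact r * (exp_minus_1 ^ k) $ r * real (x choose k))"
proof -
  have "fps_exp (real x) = (exp_minus_1 + 1) ^ x"
    by (simp add: fps_exp_power_mult)
  also have "\<dots> = (\<Sum>k\<le>x. fps_const (real (x choose k)) * exp_minus_1 ^ k)"
    by (subst binomial_ring) (simp add: fps_of_nat)
  finally have "fps_exp (real x) $ r
      = (\<Sum>k\<le>x. fps_const (real (x choose k)) * exp_minus_1 ^ k) $ r"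
    by (rule arg_cong)
  then have "real x ^ r / fact r = (\<Sum>k\<le>x. real (x choose k) * (exp_minus_1 ^ k) $ r)"
    by (simp only: fps_exp_nth of_nat_fact fps_sum_nth fps_mult_left_const_nth)
  also have "\<dots> = (\<Sum>k\<le>n. real (x choose k) * (exp_minus_1 ^ k) $ r)"
    using assms by (intro sum.mono_neutral_left) auto
  finally show ?thesis
    by (simp add: sum_distrib_left field_simps)
qed

text \<open>
  The differential equation of \<open>(exp z - 1)^(j+1)\<close>, which holds because the derivative of
  \<open>exp z - 1\<close> is \<open>(exp z - 1) + 1\<close>, compared at \<open>z^n\<close>. In terms of ordered set partitions: the element
  \<open>n + 1\<close> joins one of \<open>j + 1\<close> blocks or is a block of its own in one of \<open>j + 1\<close> places.
\<close>

lemma exp_minus_1_power_nth_Suc: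
  "real (Suc n) * (exp_minus_1 ^ Suc j) $ Suc n
     = real (Suc j) * ((exp_minus_1 ^ Suc j) $ n + (exp_minus_1 ^ j) $ n)"
proof -
  have "fps_deriv (exp_minus_1 ^ Suc j)
      = fps_const (real (Suc j)) * (exp_minus_1 ^ Suc j + exp_minus_1 ^ j)"
    by (subst fps_deriv_power) (simp add: algebra_simps)
  then have "fps_deriv (exp_minus_1 ^ Suc j) $ n
      = real (Suc j) * ((exp_minus_1 ^ Suc j) $ n + (exp_minus_1 ^ j) $ n)"
    by (simp only: fps_mult_left_const_nth fps_add_nth)
  then show ?thesis
    by (simp only: fps_deriv_nth Suc_eq_plus1 of_nat_add)
qed

section \<open>Inserting the maximum into a permutation\<close>

text \<open>
  In one-line notation the new maximum \<open>n + 1\<close> is put at position \<open>p\<close> of \<open>\<sigma>\<close>, and the entries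
  from position \<open>p\<close> on move one place to the right. The last case keeps the points outside
  \<open>{1..n+1}\<close> fixed, as \<open>permutes\<close> demands.
\<close>

definition insert_max :: "nat \<Rightarrow> nat \<Rightarrow> (nat \<Rightarrow> nat) \<Rightarrow> nat \<Rightarrow> nat" where
  "insert_max n p \<sigma> i =
     (if i < p then \<sigma> i else if i = p then Suc n else if i \<le> Suc n then \<sigma> (i - 1) else i)"

definition descents :: "nat \<Rightarrow> (nat \<Rightarrow> nat) \<Rightarrow> nat set" where
  "descents n \<sigma> = {i \<in> {1..<n}. \<sigma> i > \<sigma> (i + 1)}"

lemma des_eq_card_descents: "des n \<sigma> = card (descents n \<sigma>)"
  by (simp add: des_def descents_def)

lemma finite_descents [simp]: "finite (descents n \<sigma>)"
  by (simp add: descents_def)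

lemma des_le: "des n \<sigma> \<le> n"
proof -
  have "card (descents n \<sigma>) \<le> card {1..<n}"
    by (rule card_mono) (auto simp: descents_def)
  then show ?thesis
    by (simp add: des_eq_card_descents)
qed

lemma permutes_bounds:
  assumes "\<sigma> permutes {1..n::nat}" "i \<in> {1..n}"
  shows "1 \<le> \<sigma> i" "\<sigma> i \<le> n"
  using permutes_in_image[OF assms(1), of i] assms(2) by auto

lemma insert_max_permutes:
  assumes \<sigma>: "\<sigma> permutes {1..n}" and p: "p \<in> {1..Suc n}"
  shows "insert_max n p \<sigma> permutes {1..Suc n}"
proof (rule bij_imp_permutes)
  have inj: "inj_on (insert_max n p \<sigma>) {1..Suc n}"
  proof (rule inj_onI)
    fix i j
    assume ij: "i \<in> {1..Suc n}" "j \<in> {1..Suc n}"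
      and eq: "insert_max n p \<sigma> i = insert_max n p \<sigma> j"
    have le: "\<sigma> l \<le> n" if "l \<le> n" for l
      using permutes_bounds(2)[OF \<sigma>, of l] permutes_not_in[OF \<sigma>, of l] that by (cases l) auto
    have le': "\<sigma> (l - 1) \<le> n" if "l \<le> Suc n" for l
      using le[of "l - 1"] that by simp
    have inj: "\<sigma> a = \<sigma> b \<longleftrightarrow> a = b" for a b
      using permutes_inj[OF \<sigma>] by (simp add: inj_eq)
    show "i = j"
      using eq ij p le[of i] le[of j] le'[of i] le'[of j]
      by (auto simp: insert_max_def inj split: if_splits)
  qed
  have "insert_max n p \<sigma> i \<in> {1..Suc n}" if i: "i \<in> {1..Suc n}" for i
  proof -
    consider "i < p" | "i = p" | "p \<le> i - 1" "i - 1 \<in> {1..n}"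
      using i p by fastforce
    then show ?thesis
      using i p permutes_bounds[OF \<sigma>, of i] permutes_bounds[OF \<sigma>, of "i - 1"]
      by cases (auto simp: insert_max_def)
  qed
  then have "insert_max n p \<sigma> ` {1..Suc n} \<subseteq> {1..Suc n}"
    by blast
  with inj show "bij_betw (insert_max n p \<sigma>) {1..Suc n} {1..Suc n}"
    by (simp add: bij_betw_def endo_inj_surj)
next
  fix i
  assume "i \<notin> {1..Suc n}"
  then show "insert_max n p \<sigma> i = i"
    using p permutes_not_in[OF \<sigma>, of i] by (auto simp: insert_max_def)
qed

text \<open>
  The position of the value \<open>n + 1\<close> recovers \<open>p\<close>, and deleting it recovers \<open>\<sigma>\<close>, so the map is
  injective. Surjectivity then follows from \<open>(n + 1) \<cdot> n! = (n + 1)!\<close>.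
\<close>

lemma bij_betw_insert_max:
  "bij_betw (\<lambda>(p, \<sigma>). insert_max n p \<sigma>)
     ({1..Suc n} \<times> {\<sigma>. \<sigma> permutes {1..n}}) {\<sigma>. \<sigma> permutes {1..Suc n}}"
proof -
  let ?A = "{1..Suc n} \<times> {\<sigma>. \<sigma> permutes {1..n}}"
  let ?f = "\<lambda>(p, \<sigma>). insert_max n p \<sigma>"
  have inj: "inj_on ?f ?A"
  proof (rule inj_onI, clarify)
    fix p \<sigma> p' \<sigma>'
    assume p: "p \<in> {1..Suc n}" "p' \<in> {1..Suc n}"
      and \<sigma>: "\<sigma> permutes {1..n}" "\<sigma>' permutes {1..n}"
      and eq: "insert_max n p \<sigma> = insert_max n p' \<sigma>'"
    \<comment> \<open>Both sides are the maximum \<open>n + 1\<close>.\<close>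
    have "insert_max n p \<sigma> p = insert_max n p \<sigma> p'"
      using fun_cong[OF eq, of p'] by (simp add: insert_max_def)
    then have pp: "p = p'"
      using permutes_inj[OF insert_max_permutes[OF \<sigma>(1) p(1)]] by (simp add: inj_eq)
    have "\<sigma> i = \<sigma>' i" for i
    proof (cases "i \<in> {1..n}")
      case True
      then show ?thesis
        using fun_cong[OF eq, of i] fun_cong[OF eq, of "Suc i"] pp
        by (cases "i < p") (auto simp: insert_max_def split: if_splits)
    next
      case False
      then show ?thesis
        using permutes_not_in[OF \<sigma>(1)] permutes_not_in[OF \<sigma>(2)] by simp
    qed
    with pp show "p = p' \<and> \<sigma> = \<sigma>'"
      by auto
  qed
  have sub: "?f ` ?A \<subseteq> {\<sigma>. \<sigma> permutes {1..Suc n}}"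
    using insert_max_permutes by auto
  have "card (?f ` ?A) = card ?A"
    by (rule card_image[OF inj])
  also have "\<dots> = card {\<sigma>. \<sigma> permutes {1..Suc n}}"
    by (simp add: card_cartesian_product card_permutations)
  finally have "?f ` ?A = {\<sigma>. \<sigma> permutes {1..Suc n}}"
    using sub by (intro card_subset_eq finite_perms)
  with inj show ?thesis
    by (simp add: bij_betw_def)
qed

text \<open>
  The maximum creates a descent to its right unless it comes last, and it breaks up the pair of
  neighbours between which it is placed. Hence nothing is gained exactly when it is put at the end
  or into a descent of \<open>\<sigma>\<close>.
\<close>

lemma des_insert_max:
  assumes \<sigma>: "\<sigma> permutes {1..n}" and p: "p \<in> {1..Suc n}"
  shows "des (Suc n) (insert_max n p \<sigma>)
    = (if p \<in> insert (Suc n) (Suc ` descents n \<sigma>) then des n \<sigma> else Suc (des n \<sigma>))"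
proof -
  let ?D = "descents n \<sigma>"
  \<comment> \<open>The descents of \<open>\<sigma>\<close> to the left of the gap before position \<open>p\<close>, at this gap, and to its right.\<close>
  let ?L = "{i \<in> ?D. Suc i < p}" and ?M = "{i \<in> ?D. Suc i = p}" and ?R = "{i \<in> ?D. p \<le> i}"
  let ?P = "if p = Suc n then {} else {p}"
  have le: "\<sigma> l \<le> n" if "1 \<le> l" "l \<le> n" for l
    using permutes_bounds(2)[OF \<sigma>] that by simp
  have "descents (Suc n) (insert_max n p \<sigma>) = ?L \<union> ?P \<union> Suc ` ?R"
  proof (rule set_eqI)
    fix i
    consider "Suc i < p" | "Suc i = p" | "i = p" | "i > p"
      by linarith
    then show "i \<in> descents (Suc n) (insert_max n p \<sigma>) \<longleftrightarrow> i \<in> ?L \<union> ?P \<union> Suc ` ?R"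
    proof cases
      case 1
      then show ?thesis
        using p by (auto simp: descents_def insert_max_def)
    next
      case 2
      then show ?thesis
        using p le[of i] by (auto simp: descents_def insert_max_def)
    next
      case 3
      then show ?thesis
        using p le[of i] by (auto simp: descents_def insert_max_def less_Suc_eq_le)
    next
      case 4
      then obtain j where j: "i = Suc j" "p \<le> j"
        by (cases i) auto
      then show ?thesis
        using p by (auto simp: descents_def insert_max_def)
    qed
  qed
  moreover have "card (?L \<union> ?P \<union> Suc ` ?R) = card ?L + card ?P + card ?R"
  proof -
    have "card (?L \<union> ?P \<union> Suc ` ?R) = card (?L \<union> ?P) + card (Suc ` ?R)"
      by (intro card_Un_disjoint) auto
    also have "card (?L \<union> ?P) = card ?L + card ?P"
      by (intro card_Un_disjoint) auto
    finally show ?thesis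
      by (simp add: card_image)
  qed
  moreover have "card ?D = card ?L + card ?M + card ?R"
  proof -
    have "?D = ?L \<union> ?M \<union> ?R"
      by auto
    moreover have "card (?L \<union> ?M \<union> ?R) = card ?L + card ?M + card ?R"
    proof -
      have "card (?L \<union> ?M \<union> ?R) = card (?L \<union> ?M) + card ?R"
        by (intro card_Un_disjoint) auto
      also have "card (?L \<union> ?M) = card ?L + card ?M"
        by (intro card_Un_disjoint) auto
      finally show ?thesis .
    qed
    ultimately show ?thesis
      by simp
  qed
  moreover have "?M = (if p \<in> Suc ` ?D then {p - 1} else {})"
    by auto
  moreover have "Suc n \<notin> Suc ` ?D"
    by (auto simp: descents_def)
  ultimately show ?thesis
    by (auto simp: des_eq_card_descents)
qed

lemma sum_des_insert_max:
  fixes g :: "nat \<Rightarrow> real"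
  assumes \<sigma>: "\<sigma> permutes {1..n}"
  shows "(\<Sum>p = 1..Suc n. g (des (Suc n) (insert_max n p \<sigma>)))
    = real (Suc (des n \<sigma>)) * g (des n \<sigma>) + real (n - des n \<sigma>) * g (Suc (des n \<sigma>))"
proof -
  let ?K = "insert (Suc n) (Suc ` descents n \<sigma>)"
  have K: "?K \<subseteq> {1..Suc n}" "card ?K = Suc (des n \<sigma>)"
    by (auto simp: descents_def des_eq_card_descents card_insert_if card_image)
  have "(\<Sum>p = 1..Suc n. g (des (Suc n) (insert_max n p \<sigma>)))
      = (\<Sum>p = 1..Suc n. if p \<in> ?K then g (des n \<sigma>) else g (Suc (des n \<sigma>)))"
    by (intro sum.cong refl) (simp add: des_insert_max[OF \<sigma>])
  also have "\<dots> = (\<Sum>p \<in> ?K. g (des n \<sigma>)) + (\<Sum>p \<in> {1..Suc n} - ?K. g (Suc (des n \<sigma>)))"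
    using K(1) by (subst sum.subset_diff[OF K(1)]) (auto intro!: arg_cong2[of _ _ _ _ "(+)"] sum.cong)
  also have "card ({1..Suc n} - ?K) = n - des n \<sigma>"
    using K by (subst card_Diff_subset) (auto intro: finite_subset)
  then have "(\<Sum>p \<in> ?K. g (des n \<sigma>)) + (\<Sum>p \<in> {1..Suc n} - ?K. g (Suc (des n \<sigma>)))
      = real (Suc (des n \<sigma>)) * g (des n \<sigma>) + real (n - des n \<sigma>) * g (Suc (des n \<sigma>))"
    by (simp only: sum_constant K)
  finally show ?thesis .
qed

section \<open>Binomial moments of the number of descents\<close>

text \<open>
  A permutation of length \<open>n\<close> with \<open>d\<close> descents has \<open>d + 1\<close> extensions with \<open>d\<close> descents and
  \<open>n - d\<close> with \<open>d + 1\<close>. Expressed in binomial coefficients, the factors depending on \<open>d\<close> combine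
  into one that does not; thus the recurrence for the binomial moments closes up.
\<close>

lemma insertion_binomial_identity:
  assumes "d \<le> n"
  shows "real (Suc d) * real (d choose Suc k) + real (n - d) * real (Suc d choose Suc k)
    = (real n - real k) * (real (d choose Suc k) + real (d choose k))"
proof -
  have absorb: "(real d - real k) * real (d choose k) = real (Suc k) * real (d choose Suc k)"
  proof (cases "k \<le> d")
    case True
    have "Suc k * (d choose Suc k) = (d - k) * (d choose k)"
      using Suc_times_binomial_add[of k "d - k - 1"] True
      by (metis binomial_absorb_comp binomial_absorption)
    then show ?thesis
      using True by (metis of_nat_diff of_nat_mult)
  qed (simp add: binomial_eq_0)
  have "real (n - d) = real n - real d"
    using assms by simp
  then have "real (Suc d) * real (d choose Suc k) + real (n - d) * real (Suc d choose Suc k)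
      - (real n - real k) * (real (d choose Suc k) + real (d choose k))
      = real (Suc k) * real (d choose Suc k) - (real d - real k) * real (d choose k)"
    by (simp add: algebra_simps)
  with absorb show ?thesis
    by simp
qed

text \<open>
  Frobenius' identity. Permutations of length \<open>n + 1\<close> arise by inserting the maximum into those of
  length \<open>n\<close>, so the left-hand side for \<open>(n + 1, k)\<close> is \<open>n + 1 - k\<close> times the sum of those for
  \<open>(n, k)\<close> and \<open>(n, k - 1)\<close>. This is the recurrence of the coefficients on the right. The case
  \<open>n = 0 < k\<close> is excluded because there the truncated difference \<open>n - k\<close> would turn the right-hand
  side into 1.
\<close>

lemma sum_des_choose:
  assumes "k \<le> n"
  shows "(\<Sum>\<sigma> | \<sigma> permutes {1..n}. real (des n \<sigma> choose k)) = fact n * (exp_minus_1 ^ (n - k)) $ n"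
  using assms
proof (induction n arbitrary: k)
  case 0
  then show ?case
    by (simp add: des_def)
next
  case (Suc n)
  let ?S = "\<lambda>n. {\<sigma>. \<sigma> permutes {1..n::nat}}"
  have "(\<Sum>\<tau> \<in> ?S (Suc n). real (des (Suc n) \<tau> choose k))
      = (\<Sum>(p, \<sigma>) \<in> {1..Suc n} \<times> ?S n. real (des (Suc n) (insert_max n p \<sigma>) choose k))"
    by (subst sum.reindex_bij_betw[OF bij_betw_insert_max, symmetric]) (simp add: case_prod_unfold)
  also have "\<dots> = (\<Sum>\<sigma> \<in> ?S n. \<Sum>p = 1..Suc n. real (des (Suc n) (insert_max n p \<sigma>) choose k))"
    by (subst sum.cartesian_product[symmetric], rule sum.swap)
  also have "\<dots> = (\<Sum>\<sigma> \<in> ?S n. real (Suc (des n \<sigma>)) * real (des n \<sigma> choose k)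
      + real (n - des n \<sigma>) * real (Suc (des n \<sigma>) choose k))"
    by (intro sum.cong refl) (subst sum_des_insert_max, auto)
  finally have rec: "(\<Sum>\<tau> \<in> ?S (Suc n). real (des (Suc n) \<tau> choose k)) = \<dots>" .
  show ?case
  proof (cases k)
    case 0
    have "(exp_minus_1 ^ n) $ n = (1::real)"
      using Suc.IH[of 0] by (simp add: card_permutations)
    then have "(exp_minus_1 ^ Suc n) $ Suc n = (1::real)"
      using exp_minus_1_power_nth_Suc[of n n] exp_minus_1_power_nth_eq_0[of n "Suc n"] by simp
    then show ?thesis
      using 0 by (simp add: card_permutations algebra_simps)
  next
    case (Suc l)
    have l: "l \<le> n"
      using Suc Suc.prems by simp
    have "(\<Sum>\<tau> \<in> ?S (Suc n). real (des (Suc n) \<tau> choose k))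
        = (\<Sum>\<sigma> \<in> ?S n. (real n - real l) * (real (des n \<sigma> choose Suc l) + real (des n \<sigma> choose l)))"
      unfolding rec unfolding Suc by (intro sum.cong refl insertion_binomial_identity des_le)
    also have "\<dots> = (real n - real l) * ((\<Sum>\<sigma> \<in> ?S n. real (des n \<sigma> choose Suc l))
        + (\<Sum>\<sigma> \<in> ?S n. real (des n \<sigma> choose l)))"
      by (simp add: sum_distrib_left[symmetric] sum.distrib)
    also have "\<dots> = fact (Suc n) * (exp_minus_1 ^ (n - l)) $ Suc n"
    proof (cases "l = n")
      case False
      then obtain j where j: "n - l = Suc j" "n - Suc l = j" "real n - real l = real (Suc j)"
        using l by (metis Suc_diff_Suc le_neq_implies_less of_nat_diff)
      have "(real n - real l) * ((\<Sum>\<sigma> \<in> ?S n. real (des n \<sigma> choose Suc l))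
          + (\<Sum>\<sigma> \<in> ?S n. real (des n \<sigma> choose l)))
          = fact n * (real (Suc j) * ((exp_minus_1 ^ Suc j) $ n + (exp_minus_1 ^ j) $ n))"
        using Suc.IH[of "Suc l"] Suc.IH[of l] l False j by (simp add: algebra_simps)
      also have "\<dots> = fact (Suc n) * (exp_minus_1 ^ Suc j) $ Suc n"
        by (subst exp_minus_1_power_nth_Suc[symmetric]) simp
      finally show ?thesis
        using j by simp
    qed simp
    finally show ?thesis
      using Suc by simp
  qed
qed

section \<open>Separating the parts equal to one\<close>

text \<open>The exponential generating function of sets with at least two elements.\<close>

abbreviation exp_tail :: "real fps" where
  "exp_tail \<equiv> fps_exp 1 - 1 - fps_X"

text \<open>
  Of the \<open>n - k\<close> blocks, \<open>n - k - u\<close> are singletons; the other \<open>u\<close> have total size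
  \<open>n - (n - k - u) = k + u\<close>.
\<close>

lemma exp_minus_1_power_nth:
  assumes "k \<le> n"
  shows "(exp_minus_1 ^ (n - k)) $ n
    = (\<Sum>u\<le>n - k. real ((n - k) choose u) * (exp_tail ^ u) $ (k + u))"
proof -
  have "exp_minus_1 ^ (n - k) = (exp_tail + fps_X) ^ (n - k)"
    by simp
  also have "\<dots> = (\<Sum>u\<le>n - k. fps_const (real ((n - k) choose u)) * (exp_tail ^ u * fps_X ^ (n - k - u)))"
    by (subst binomial_ring) (simp only: fps_of_nat mult.assoc)
  finally have "(exp_minus_1 ^ (n - k)) $ n
      = (\<Sum>u\<le>n - k. real ((n - k) choose u) * (exp_tail ^ u * fps_X ^ (n - k - u)) $ n)"
    by (simp only: fps_sum_nth fps_mult_left_const_nth)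
  also have "\<dots> = (\<Sum>u\<le>n - k. real ((n - k) choose u) * (exp_tail ^ u) $ (k + u))"
    using assms by (intro sum.cong refl) (auto simp: fps_X_power_mult_right_nth intro!: arg_cong2[of _ _ _ _ "($)"])
  finally show ?thesis .
qed

lemma tuples_ge2_Suc:
  "tuples_ge2 m (Suc u) = (\<lambda>(i, q). i # q) ` (SIGMA i:{2..m}. tuples_ge2 (m - i) u)"
proof (intro equalityI subsetI)
  fix x
  assume "x \<in> tuples_ge2 m (Suc u)"
  then obtain i q where "x = i # q" "length q = u" "i + sum_list q = m" "2 \<le> i" "\<forall>x\<in>set q. 2 \<le> x"
    by (cases x) (auto simp: tuples_ge2_def)
  then show "x \<in> (\<lambda>(i, q). i # q) ` (SIGMA i:{2..m}. tuples_ge2 (m - i) u)"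
    by (intro image_eqI[of _ _ "(i, q)"]) (auto simp: tuples_ge2_def)
qed (auto simp: tuples_ge2_def)

text \<open>
  By the product formula for power series, \<open>[z^m] G^u\<close> is the sum of \<open>1 / (q\<^sub>1! \<dots> q\<^sub>u!)\<close>
  over the tuples, where \<open>G\<close> is the series \<open>exp_tail\<close>; the factor \<open>m!\<close> of the multinomial
  coefficient cancels.
\<close>

lemma exp_tail_power_nth:
  "(exp_tail ^ u) $ m = (\<Sum>q \<in> tuples_ge2 m u. multinomial m q) / fact m"
proof -
  have "(exp_tail ^ u) $ m = (\<Sum>q \<in> tuples_ge2 m u. 1 / (\<Prod>x\<leftarrow>q. fact x))"
  proof (induction u arbitrary: m)
    case 0
    have "tuples_ge2 m 0 = (if m = 0 then {[]} else {})"
      by (auto simp: tuples_ge2_def)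
    then show ?case
      by simp
  next
    case (Suc u)
    have nth: "exp_tail $ i = (if 2 \<le> i then 1 / fact i else 0)" for i
      by (auto simp: fps_X_nth less_2_cases_iff not_le)
    have "(exp_tail ^ Suc u) $ m = (\<Sum>i = 0..m. exp_tail $ i * (exp_tail ^ u) $ (m - i))"
      by (simp only: power_Suc fps_mult_nth)
    also have "\<dots> = (\<Sum>i = 2..m. 1 / fact i * (exp_tail ^ u) $ (m - i))"
      by (intro sum.mono_neutral_cong_right) (auto simp only: nth, auto)
    also have "\<dots> = (\<Sum>i = 2..m. \<Sum>q \<in> tuples_ge2 (m - i) u. 1 / (\<Prod>x\<leftarrow>i # q. fact x))"
      unfolding Suc.IH by (simp add: sum_distrib_left)
    also have "\<dots> = (\<Sum>(i, q) \<in> (SIGMA i:{2..m}. tuples_ge2 (m - i) u). 1 / (\<Prod>x\<leftarrow>i # q. fact x))"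
      by (intro sum.Sigma) (auto simp: finite_tuples_ge2)
    also have "\<dots> = (\<Sum>q \<in> tuples_ge2 m (Suc u). 1 / (\<Prod>x\<leftarrow>q. fact x))"
      unfolding tuples_ge2_Suc by (subst sum.reindex) (auto simp: inj_on_def case_prod_unfold)
    finally show ?case .
  qed
  then show ?thesis
    by (simp add: multinomial_def sum_divide_distrib)
qed

lemma tuples_ge2_empty:
  assumes "m < 2 * u"
  shows "tuples_ge2 m u = {}"
proof -
  have "2 * length q \<le> sum_list q" if "\<forall>x\<in>set q. 2 \<le> x" for q :: "nat list"
    using that by (induction q) auto
  with assms show ?thesis
    by (fastforce simp: tuples_ge2_def)
qed

section \<open>The moments\<close>

lemma expectation_des_power:
  "measure_pmf.expectation (uniform_perm n) (\<lambda>\<sigma>. real (des n \<sigma>) ^ r)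
    = (\<Sum>k\<le>n. fact r * (exp_minus_1 ^ k) $ r * (exp_minus_1 ^ (n - k)) $ n)"
proof -
  have "(\<Sum>\<sigma> | \<sigma> permutes {1..n}. real (des n \<sigma>) ^ r)
      = (\<Sum>k\<le>n. fact r * (exp_minus_1 ^ k) $ r * (\<Sum>\<sigma> | \<sigma> permutes {1..n}. real (des n \<sigma> choose k)))"
    by (subst power_eq_sum_binomial[OF des_le], subst sum.swap) (simp only: sum_distrib_left)
  also have "\<dots> = fact n * (\<Sum>k\<le>n. fact r * (exp_minus_1 ^ k) $ r * (exp_minus_1 ^ (n - k)) $ n)"
    unfolding sum_distrib_left[of "fact n"] by (intro sum.cong refl) (subst sum_des_choose, auto)
  finally show ?thesis
    unfolding uniform_perm_def
    by (subst integral_pmf_of_set[OF perms_nonempty finite_perms]) (simp add: card_permutations)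
qed

theorem theorem5p2:
  fixes n r :: nat
  assumes "r \<ge> 1"
  shows "measure_pmf.expectation (uniform_perm n) (\<lambda>\<sigma>. real (des n \<sigma>) ^ r) =
    (\<Sum>m = 2..min n (2 * r). \<Sum>u = 1..m div 2.
       (\<Sum>w = 0..m - u. (-1) ^ w * real ((m - u) choose w) * real (m - u - w) ^ r)
       * (\<Sum>q \<in> tuples_ge2 m u. multinomial m q)
       * (real ((n - (m - u)) choose u) / fact m))"
proof -
  define g where "g k u = fact r * (exp_minus_1 ^ k) $ r
    * (real ((n - k) choose u) * (exp_tail ^ u) $ (k + u))" for k u
  \<comment> \<open>With these terms removed, \<open>m = k + u\<close> satisfies \<open>2 u \<le> m \<le> 2 r\<close>.\<close>
  have g_0: "g k u = 0" if "k = 0 \<or> u = 0 \<or> r < k \<or> k < u" for k u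
  proof (cases "k = 0 \<or> r < k")
    case True
    then have "(exp_minus_1 ^ k) $ r = 0"
      using assms exp_minus_1_power_nth_eq_0[of r k] by auto
    then show ?thesis
      by (simp only: g_def mult_zero_left mult_zero_right)
  next
    case False
    with that have "k + u < 2 * u \<or> u = 0 \<and> k \<noteq> 0"
      by linarith
    then have "(exp_tail ^ u) $ (k + u) = 0"
    proof
      assume "k + u < 2 * u"
      then show ?thesis
        by (simp only: exp_tail_power_nth tuples_ge2_empty sum.empty div_0)
    qed simp
    then show ?thesis
      by (simp only: g_def mult_zero_right)
  qed
  have "measure_pmf.expectation (uniform_perm n) (\<lambda>\<sigma>. real (des n \<sigma>) ^ r)
      = (\<Sum>k\<le>n. \<Sum>u\<le>n - k. g k u)"
    unfolding expectation_des_power g_def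
    by (intro sum.cong refl) (simp only: exp_minus_1_power_nth sum_distrib_left atMost_iff)
  also have "\<dots> = (\<Sum>(k, u) \<in> (SIGMA k:{..n}. {..n - k}). g k u)"
    by (rule sum.Sigma) auto
  also have "\<dots> = (\<Sum>(k, u) \<in> {(k, u). 1 \<le> u \<and> u \<le> k \<and> k \<le> r \<and> k + u \<le> n}. g k u)"
    by (intro sum.mono_neutral_right) (auto simp: not_le intro!: g_0)
  also have "\<dots> = (\<Sum>(m, u) \<in> (SIGMA m:{2..min n (2 * r)}. {1..m div 2}). g (m - u) u)"
  proof -
    have "(\<Sum>(m, u) \<in> (SIGMA m:{2..min n (2 * r)}. {1..m div 2}). g (m - u) u)
        = (\<Sum>(m, u) \<in> {(m, u). 1 \<le> u \<and> 2 * u \<le> m \<and> m - u \<le> r \<and> m \<le> n}. g (m - u) u)"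
      by (intro sum.mono_neutral_right) (auto simp: not_le intro!: g_0)
    also have "\<dots> = (\<Sum>(k, u) \<in> {(k, u). 1 \<le> u \<and> u \<le> k \<and> k \<le> r \<and> k + u \<le> n}. g k u)"
      by (rule sum.reindex_bij_witness[where i = "\<lambda>(k, u). (k + u, u)" and j = "\<lambda>(m, u). (m - u, u)"])
         auto
    finally show ?thesis ..
  qed
  also have "\<dots> = (\<Sum>m = 2..min n (2 * r). \<Sum>u = 1..m div 2. g (m - u) u)"
    by (rule sum.Sigma[symmetric]) auto
  also have "\<dots> = (\<Sum>m = 2..min n (2 * r). \<Sum>u = 1..m div 2.
       (\<Sum>w = 0..m - u. (-1) ^ w * real ((m - u) choose w) * real (m - u - w) ^ r)
       * (\<Sum>q \<in> tuples_ge2 m u. multinomial m q)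
       * (real ((n - (m - u)) choose u) / fact m))"
  proof (intro sum.cong refl)
    fix m u :: nat
    assume "u \<in> {1..m div 2}"
    then have "m - u + u = m"
      by auto
    then show "g (m - u) u =
       (\<Sum>w = 0..m - u. (-1) ^ w * real ((m - u) choose w) * real (m - u - w) ^ r)
       * (\<Sum>q \<in> tuples_ge2 m u. multinomial m q)
       * (real ((n - (m - u)) choose u) / fact m)"
      unfolding surjection_count_fps
      by (simp only: g_def exp_tail_power_nth times_divide_eq_left times_divide_eq_right mult_ac)
  qed
  finally show ?thesis .
qed

end
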